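(* For all integers $k\ge 3$, it holds that $g(4,k)\ge \left\lfloor \frac{2k^3+3k^2+22k}{24}\right\rfloor$.
   Context: A state with $k$ vessels is a vector $A=(a_1,\dots,a_k)$ of non-negative integers (the contents of the vessels). A pouring step chooses two distinct vessels with contents $x$ and $y$, where $x\le y$, and replaces these contents by $2x$ (for the vessel that contained $x$) and $y-x$ (for the vessel that contained $y$); all other contents are unchanged. For an integer $p\ge 0$, a state is $p$-pourable if some sequence of at most $p$ pouring steps leads to a state in which at least one vessel has content $0$. For positive integers $N$ and $k\ge 3$, $g(N,k)$ is the smallest positive integer $n$ such that some state $A=(a_1,\dots,a_k)$ with $a_1+\cdots+a_k=n$ is not $(N-1)$-pourable. *)

theory Defs
  imports Complex_Main
begin

definition pouring_step :: "nat list \<Rightarrow> nat list \<Rightarrow> bool" where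
  "pouring_step A B \<longleftrightarrow>
     (\<exists>i<length A. \<exists>j<length A. i \<noteq> j \<and> A ! i \<le> A ! j \<and>
        B = A[i := 2 * A ! i, j := A ! j - A ! i])"

definition pourable :: "nat \<Rightarrow> nat list \<Rightarrow> bool" where
  "pourable p A \<longleftrightarrow> (\<exists>m\<le>p. \<exists>B. (pouring_step ^^ m) A B \<and> 0 \<in> set B)"

(* Only meaningful for N \<ge> 1 and k \<ge> 3: LEAST returns an unspecified value if no n qualifies. *)
definition g :: "nat \<Rightarrow> nat \<Rightarrow> nat" where
  "g N k = (LEAST n. n > 0 \<and>
     (\<exists>A. length A = k \<and> sum_list A = n \<and> \<not> pourable (N - 1) A))"

end

theory Submission
  imports Defs
begin

text \<open>
  If four distinct vessels satisfy a + b = c + d with a \<le> c, then c - a = b - d, so pouring a with c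
  and d with b creates two equal contents and a third step empties a vessel. Hence in a state that
  is not 3-pourable all contents are positive and distinct, and all sums of two contents are
  distinct. With k contents this gives (k choose 2) distinct pair sums, all at least 3, so the two
  largest contents add up to at least (k choose 2) + 2; peeling off the two largest contents
  repeatedly yields the bound.

  The minimum defining g exists because each step is an injective linear map with small
  coefficients: if the contents are powers of a large base, no short integer combination of them
  vanishes, and three steps only shorten the admissible combinations.
\<close>

text \<open>The cubic f(n) on the left satisfies f(n+2) - f(n) = 24 * ((n+2 choose 2) + 2), which
  matches the bound for the two largest elements, so induction in steps of two loses nothing. The
  slack 3 comes from the odd base case: \<open>S = {1}\<close> gives 27 = 24 + 3.\<close>

lemma weak_sidon_sum_lower_bound:
  fixes S :: "nat set"
  assumes "finite S" "0 \<notin> S"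
    and "\<And>a b c d. \<lbrakk>a \<in> S; b \<in> S; c \<in> S; d \<in> S; distinct [a, b, c, d]\<rbrakk> \<Longrightarrow> a + b \<noteq> c + d"
  shows "2 * card S ^ 3 + 3 * card S ^ 2 + 22 * card S \<le> 24 * \<Sum>S + 3"
  using assms
proof (induction "card S" arbitrary: S rule: less_induct)
  case less
  note fin = less.prems(1) and pos = less.prems(2) and sidon = less.prems(3)
  consider "card S = 0" | "card S = 1" | "card S \<ge> 2" by linarith
  then show ?case
  proof cases
    case 1
    then show ?thesis by simp
  next
    case 2
    then obtain x where "S = {x}" by (auto simp: card_1_singleton_iff)
    with pos show ?thesis by simp
  next
    case 3
    define M where "M = Max S"
    define T where "T = S - {M}"
    define M' where "M' = Max T"
    define U where "U = T - {M'}"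
    have "S \<noteq> {}" using 3 by auto
    then have M: "M \<in> S" and M_max: "\<And>x. x \<in> S \<Longrightarrow> x \<le> M"
      using fin by (auto simp: M_def)
    have card_T: "card T = card S - 1" and "finite T" using M fin by (auto simp: T_def)
    have "T \<noteq> {}" using card_T 3 by auto
    then have M': "M' \<in> T" and M'_max: "\<And>x. x \<in> T \<Longrightarrow> x \<le> M'"
      using \<open>finite T\<close> by (auto simp: M'_def)
    have card_U: "card U = card S - 2" using card_T M' \<open>finite T\<close> by (simp add: U_def)
    have sum_S: "\<Sum>S = M + M' + \<Sum>U"
      using sum.remove[OF fin M, of id] sum.remove[OF \<open>finite T\<close> M', of id]
      by (simp add: T_def U_def)
    have IH: "2 * card U ^ 3 + 3 * card U ^ 2 + 22 * card U \<le> 24 * \<Sum>U + 3"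
    proof (rule less.hyps)
      show "card U < card S" using card_U 3 by simp
    qed (use fin pos sidon in \<open>auto simp: U_def T_def\<close>)
    define P where "P = {B. B \<subseteq> S \<and> card B = 2}"
    have inj: "inj_on Sum P"
    proof (rule inj_onI)
      fix B C assume B: "B \<in> P" and C: "C \<in> P" and eq: "\<Sum>B = \<Sum>C"
      obtain a b where ab: "B = {a, b}" "a \<noteq> b" "a \<in> S" "b \<in> S"
        using B by (auto simp: P_def card_2_iff)
      obtain c d where cd: "C = {c, d}" "c \<noteq> d" "c \<in> S" "d \<in> S"
        using C by (auto simp: P_def card_2_iff)
      have sum_eq: "a + b = c + d" using eq ab cd by simp
      then have "\<not> distinct [a, b, c, d]" using sidon ab cd by blast
      \<comment> \<open>The two pairs share an element, so cancelling it from \<open>sum_eq\<close>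
        identifies the other elements too.\<close>
      then show "B = C" using ab cd sum_eq by auto
    qed
    \<comment> \<open>Two distinct positive integers sum to at least 1 + 2.\<close>
    have "Sum ` P \<subseteq> {3..M + M'}"
    proof
      fix s assume "s \<in> Sum ` P"
      then obtain a b where ab: "s = a + b" "a \<noteq> b" "a \<in> S" "b \<in> S"
        by (auto simp: P_def card_2_iff)
      then have "a \<noteq> 0" "b \<noteq> 0" using pos by metis+
      moreover have "a + b \<le> M + M'"
        using ab M_max[of a] M_max[of b] M'_max[of a] M'_max[of b]
        by (cases "a = M"; cases "b = M") (simp_all add: T_def)
      ultimately show "s \<in> {3..M + M'}" using ab by auto
    qed
    then have "card (Sum ` P) \<le> card {3..M + M'}" by (intro card_mono) auto
    then have "card (Sum ` P) \<le> M + M' - 2" by simp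
    then have "card S choose 2 \<le> M + M' - 2"
      using card_image[OF inj] n_subsets[OF fin] by (simp add: P_def)
    \<comment> \<open>Positivity shows that \<open>M + M' - 2\<close> is not truncated to 0, so the
      2 can be moved across.\<close>
    moreover have "card S choose 2 > 0" using 3 by simp
    ultimately have pairs: "(card S choose 2) + 2 \<le> M + M'" by linarith
    obtain n where n: "card S = n + 2" using 3 by (metis le_add_diff_inverse2)
    have twice: "2 * (card S choose 2) = (n + 2) * (n + 1)" by (simp add: n choose_two)
    have "(n + 2) * (n + 1) + 4 \<le> 2 * (M + M')"
      unfolding twice[symmetric] using pairs by simp
    moreover have "card U = n" using card_U n by simp
    ultimately show ?thesis
      using IH unfolding sum_S n by (simp add: power2_eq_square power3_eq_cube algebra_simps)
  qed
qed

lemma pourable_SucI: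
  assumes "pouring_step A B" "pourable p B"
  shows "pourable (Suc p) A"
  using assms unfolding pourable_def by (metis Suc_le_mono relpowp_Suc_I2)

lemma pourable_mono: "pourable p A \<Longrightarrow> p \<le> q \<Longrightarrow> pourable q A"
  unfolding pourable_def by (meson le_trans)

lemma pouring_stepI:
  assumes "i < length A" "j < length A" "i \<noteq> j" "A ! i \<le> A ! j"
  shows "pouring_step A (A[i := 2 * A ! i, j := A ! j - A ! i])"
  using assms unfolding pouring_step_def by blast

lemma pourable_0_if_zero: "0 \<in> set A \<Longrightarrow> pourable 0 A"
  by (auto simp: pourable_def)

lemma pourable_1_if_equal:
  assumes "i < length A" "j < length A" "i \<noteq> j" "A ! i = A ! j"
  shows "pourable (Suc 0) A"
proof (rule pourable_SucI)
  show "pouring_step A (A[i := 2 * A ! i, j := A ! j - A ! i])"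
    using assms by (intro pouring_stepI) auto
  show "pourable 0 (A[i := 2 * A ! i, j := A ! j - A ! i])"
    using assms by (intro pourable_0_if_zero) (auto simp: in_set_conv_nth intro!: exI[of _ j])
qed

lemma pourable_3_if_equal_differences:
  assumes "p < length A" "q < length A" "r < length A" "s < length A" "distinct [p, q, r, s]"
    and "A ! p \<le> A ! q" "A ! r \<le> A ! s" "A ! q - A ! p = A ! s - A ! r"
  shows "pourable 3 A"
proof -
  define B where "B = A[p := 2 * A ! p, q := A ! q - A ! p]"
  define C where "C = B[r := 2 * B ! r, s := B ! s - B ! r]"
  have "pouring_step A B" unfolding B_def using assms by (intro pouring_stepI) auto
  moreover have "pouring_step B C"
    unfolding C_def using assms by (intro pouring_stepI) (auto simp: B_def)
  \<comment> \<open>The index pairs are disjoint, so \<open>q\<close> and \<open>s\<close> now both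
    hold the common difference.\<close>
  moreover have "pourable (Suc 0) C"
    using assms by (intro pourable_1_if_equal[of q _ s]) (auto simp: B_def C_def)
  ultimately show ?thesis
    unfolding numeral_3_eq_3 by (blast intro: pourable_SucI)
qed

lemma not_pourable_3_sum_lower_bound:
  assumes "\<not> pourable 3 A"
  shows "2 * length A ^ 3 + 3 * length A ^ 2 + 22 * length A \<le> 24 * sum_list A + 3"
proof -
  have dist: "distinct A"
    using pourable_1_if_equal pourable_mono[of "Suc 0" A 3] assms
    by (force simp: distinct_conv_nth)
  have "0 \<notin> set A" using pourable_0_if_zero pourable_mono[of 0 A 3] assms by auto
  moreover have "a + b \<noteq> c + d"
    if mem: "a \<in> set A" "b \<in> set A" "c \<in> set A" "d \<in> set A" and ne: "distinct [a, b, c, d]"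
    for a b c d
  proof
    assume eq: "a + b = c + d"
    obtain i j k l where ijkl: "i < length A" "j < length A" "k < length A" "l < length A"
      and nth: "A ! i = a" "A ! j = b" "A ! k = c" "A ! l = d"
      using mem by (auto simp: in_set_conv_nth)
    have idx: "distinct [i, j, k, l]" using ne nth by auto
    show False
    proof (cases "a \<le> c")
      case True
      then have "d \<le> b" "c - a = b - d" using eq by arith+
      then show False
        using pourable_3_if_equal_differences[of i A k l j] assms ijkl nth idx True by simp
    next
      case False
      then have "c \<le> a" "b \<le> d" "a - c = d - b" using eq by arith+
      then show False
        using pourable_3_if_equal_differences[of k A i j l] assms ijkl nth idx by simp
    qed
  qed
  ultimately have "2 * card (set A) ^ 3 + 3 * card (set A) ^ 2 + 22 * card (set A)
      \<le> 24 * \<Sum>(set A) + 3"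
    by (intro weak_sidon_sum_lower_bound) auto
  then show ?thesis
    using dist by (simp add: distinct_card distinct_sum_list_conv_Sum)
qed

text \<open>Linear independence over integer coefficients of absolute value at most
  \<open>R\<close>. For \<open>R\<close> at least 1 it excludes a zero content, and unlike
  positivity it can be tracked through pouring.\<close>

definition no_short_relation :: "int \<Rightarrow> nat list \<Rightarrow> bool" where
  "no_short_relation R A \<longleftrightarrow>
     (\<forall>d. (\<forall>l<length A. \<bar>d l\<bar> \<le> R) \<longrightarrow> (\<Sum>l<length A. d l * int (A ! l)) = 0 \<longrightarrow>
        (\<forall>l<length A. d l = 0))"

text \<open>Modulo \<open>b\<close> only \<open>d 0\<close> survives, so \<open>b\<close> divides
  it; being smaller than \<open>b\<close> in absolute value it is 0. Dividing the relation by
  \<open>b\<close> shifts the remaining coefficients down.\<close>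

lemma no_short_relation_powers:
  fixes d :: "nat \<Rightarrow> int"
  assumes "\<And>l. l < k \<Longrightarrow> \<bar>d l\<bar> < b" "(\<Sum>l<k. d l * b ^ l) = 0" "l < k"
  shows "d l = 0"
  using assms
proof (induction k arbitrary: d l)
  case 0
  then show ?case by simp
next
  case (Suc k)
  have "(\<Sum>l<Suc k. d l * b ^ l) = d 0 + b * (\<Sum>l<k. d (Suc l) * b ^ l)"
    by (simp add: sum.lessThan_Suc_shift sum_distrib_left mult_ac del: sum.lessThan_Suc)
  then have split: "d 0 + b * (\<Sum>l<k. d (Suc l) * b ^ l) = 0" using Suc.prems(2) by simp
  have "d 0 = b * - (\<Sum>l<k. d (Suc l) * b ^ l)" using split by simp
  then have "b dvd d 0" by (rule dvdI)
  then have d0: "d 0 = 0" using Suc.prems(1)[of 0] dvd_imp_le_int[of "d 0" b] by fastforce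
  have "b \<noteq> 0" using Suc.prems(1)[of 0] by auto
  then have "(\<Sum>l<k. d (Suc l) * b ^ l) = 0" using split d0 by simp
  then have "d (Suc m) = 0" if "m < k" for m
    using Suc.IH[of "\<lambda>l. d (Suc l)" m] Suc.prems(1) that by simp
  then show ?case using d0 Suc.prems(3) by (cases l) auto
qed

lemma no_short_relation_step:
  assumes "no_short_relation (3 * R) A" "pouring_step A B"
  shows "no_short_relation R B"
proof -
  obtain i j where ij: "i < length A" "j < length A" "i \<noteq> j" "A ! i \<le> A ! j"
    and B: "B = A[i := 2 * A ! i, j := A ! j - A ! i]"
    using assms(2) unfolding pouring_step_def by blast
  show ?thesis
    unfolding no_short_relation_def
  proof (intro allI impI)
    fix d l
    assume bd: "\<forall>l<length B. \<bar>d l\<bar> \<le> R" and zero: "(\<Sum>l<length B. d l * int (B ! l)) = 0"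
      and l: "l < length B"
    \<comment> \<open>With x and y the old contents of \<open>i\<close> and \<open>j\<close>, the
      new terms 2x * \<open>d i\<close> + (y - x) * \<open>d j\<close> regroup as (2 *
      \<open>d i\<close> - \<open>d j\<close>) * x + \<open>d j\<close> * y. Hence the factor 3 in
      the bound; \<open>d\<close> can be recovered from \<open>e\<close>.\<close>
    define e where "e = d(i := 2 * d i - d j)"
    have "(\<Sum>l<length A. e l * int (A ! l)) - (\<Sum>l<length A. d l * int (B ! l))
        = (\<Sum>l<length A. (if l = j then d j * int (A ! i) else 0)
            - (if l = i then d j * int (A ! i) else 0))"
      unfolding sum_subtractf[symmetric]
      using ij by (intro sum.cong) (auto simp: e_def B algebra_simps of_nat_diff)
    also have "\<dots> = 0" using ij by (simp add: sum_subtractf)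
    finally have "(\<Sum>l<length A. e l * int (A ! l)) = 0" using zero B by simp
    moreover have "\<forall>l<length A. \<bar>e l\<bar> \<le> 3 * R"
    proof (intro allI impI)
      fix l assume "l < length A"
      then have "\<bar>d l\<bar> \<le> R" "\<bar>d i\<bar> \<le> R" "\<bar>d j\<bar> \<le> R" using bd ij B by auto
      then show "\<bar>e l\<bar> \<le> 3 * R" by (auto simp: e_def)
    qed
    ultimately have e0: "\<forall>l<length A. e l = 0"
      using assms(1) unfolding no_short_relation_def by blast
    then have "d j = 0" using ij by (auto simp: e_def)
    then have "d i = 0" using e0 ij by (auto simp: e_def)
    then show "d l = 0" using e0 l B by (cases "l = i") (auto simp: e_def)
  qed
qed

lemma no_short_relation_steps:
  assumes "(pouring_step ^^ m) A B" "no_short_relation (3 ^ m * R) A"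
  shows "no_short_relation R B"
  using assms
proof (induction m arbitrary: B R)
  case 0
  then show ?case by simp
next
  case (Suc m)
  then obtain C where "(pouring_step ^^ m) A C" "pouring_step C B" by auto
  then show ?case using Suc.IH[of C "3 * R"] Suc.prems no_short_relation_step
    by (simp add: mult_ac)
qed

text \<open>An empty vessel yields a relation whose only nonzero coefficient is 1, and after m \<le>
  p steps the admissible bound is still 3 ^ (p - m) \<ge> 1.\<close>

lemma not_pourable_if_no_short_relation:
  assumes "no_short_relation (3 ^ p) A"
  shows "\<not> pourable p A"
proof
  assume "pourable p A"
  then obtain m B where m: "m \<le> p" "(pouring_step ^^ m) A B" "0 \<in> set B"
    unfolding pourable_def by blast
  then have "no_short_relation (3 ^ (p - m)) B"
    using no_short_relation_steps assms by (metis le_add_diff_inverse power_add)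
  moreover obtain i where i: "i < length B" "B ! i = 0" using m by (auto simp: in_set_conv_nth)
  moreover have "(\<Sum>l<length B. (if l = i then 1 else 0) * int (B ! l)) = 0"
    using i by (intro sum.neutral) auto
  ultimately show False
    unfolding no_short_relation_def by (auto dest!: spec[of _ "\<lambda>l. if l = i then 1 else 0"])
qed

lemma ex_not_pourable: "\<exists>A. length A = k \<and> \<not> pourable p A"
proof -
  \<comment> \<open>The base exceeds the coefficient bound 3 ^ p by one, as the strict inequality in
    \<open>no_short_relation_powers\<close> requires.\<close>
  define A where "A = map (\<lambda>l. (3 ^ p + 1 :: nat) ^ l) [0..<k]"
  have "no_short_relation (3 ^ p) A"
    unfolding no_short_relation_def
  proof (intro allI impI)
    fix d l
    assume bd: "\<forall>l<length A. \<bar>d l\<bar> \<le> 3 ^ p"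
      and zero: "(\<Sum>l<length A. d l * int (A ! l)) = 0" and l: "l < length A"
    show "d l = 0"
    proof (rule no_short_relation_powers)
      show "\<bar>d m\<bar> < 3 ^ p + 1" if "m < k" for m using bd that by (simp add: A_def)
      show "(\<Sum>l<k. d l * (3 ^ p + 1) ^ l) = 0"
        using zero by (simp add: A_def add.commute)
      show "l < k" using l by (simp add: A_def)
    qed
  qed
  then show ?thesis
    using not_pourable_if_no_short_relation by (intro exI[of _ A]) (simp add: A_def)
qed

theorem theorem27:
  fixes k :: nat
  assumes "k \<ge> 3"
  shows "int (g 4 k) \<ge> \<lfloor>real (2 * k^3 + 3 * k^2 + 22 * k) / 24\<rfloor>"
proof -
  let ?P = "\<lambda>n. n > 0 \<and> (\<exists>A. length A = k \<and> sum_list A = n \<and> \<not> pourable (4 - 1) A)"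
  obtain A where A: "length A = k" "\<not> pourable 3 A" using ex_not_pourable by blast
  have "sum_list A > 0"
    using not_pourable_3_sum_lower_bound[OF A(2)] A(1) assms by (cases "sum_list A = 0") auto
  with A have "\<exists>n. ?P n" by auto
  \<comment> \<open>\<open>g 4 k\<close> is itself the sum of a state that is not 3-pourable, so the
    bound for such states applies to it.\<close>
  then have "?P (g 4 k)" unfolding g_def by (rule LeastI_ex)
  then have "2 * k ^ 3 + 3 * k ^ 2 + 22 * k \<le> 24 * g 4 k + 3"
    using not_pourable_3_sum_lower_bound by fastforce
  then have "real (2 * k ^ 3 + 3 * k ^ 2 + 22 * k) \<le> real (24 * g 4 k + 3)"
    by (rule of_nat_mono)
  \<comment> \<open>The slack contributes 3/24 < 1, which the floor absorbs.\<close>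
  then have "real (2 * k ^ 3 + 3 * k ^ 2 + 22 * k) / 24 < real (g 4 k) + 1"
    unfolding of_nat_add[of "24 * g 4 k"] of_nat_mult[of 24] by simp
  then show ?thesis by linarith
qed

end
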